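(* Let $\mathfrak g=\mathfrak{sl}_2(\mathbb C)$ with standard basis $e,h,f$ and brackets $[h,e]=2e$, $[h,f]=-2f$, $[e,f]=h$. Let $B$ be the invariant symmetric bilinear form on $\mathfrak g$ normalized by $B(e,f)=1$ and $B(h,h)=2$. Set $\mathcal N:=\{u\in\mathfrak g\mid B(u,u)=0\}$. For $u\in\mathcal N$ define $T_u(x):=B(x,u)u$ and $x\circ_u y:=T_u([x,y])-[T_u(x),y]$ for $x,y\in\mathfrak g$. Then the assignment $u\mapsto\circ_u$ induces a bijection from $\mathcal N/\{\pm1\}$ onto the set of all GD products on the fixed Lie algebra $\mathfrak{sl}_2(\mathbb C)$.
   Context: A Novikov algebra is a vector space with a bilinear product $\circ$ satisfying $(x\circ y)\circ z-x\circ(y\circ z)=(y\circ x)\circ z-y\circ(x\circ z)$ and $(x\circ y)\circ z=(x\circ z)\circ y$. A Gelfand--Dorfman (GD) algebra is a triple $(A,\circ,[\cdot,\cdot])$ such that $(A,\circ)$ is a Novikov algebra, $(A,[\cdot,\cdot])$ is a Lie algebra, and for all $x,y,z\in A$: $[x,y\circ z]-[z,y\circ x]+[y,x]\circ z-[y,z]\circ x-y\circ[x,z]=0$. A GD product on a fixed Lie algebra $(\mathfrak g,[\cdot,\cdot])$ is a bilinear product $\circ$ on $\mathfrak g$ such that $(\mathfrak g,\circ,[\cdot,\cdot])$ is a GD algebra. $\mathcal N/\{\pm1\}$ is the quotient of $\mathcal N$ by the relation $u\sim -u$. *)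

theory Defs
  imports "HOL-Analysis.Analysis"
begin

section \<open>Novikov, Lie and Gelfand--Dorfman algebras\<close>

definition bilinear_map ::
    "('k::field \<Rightarrow> 'a::ab_group_add \<Rightarrow> 'a) \<Rightarrow> ('k \<Rightarrow> 'b::ab_group_add \<Rightarrow> 'b)
      \<Rightarrow> ('a \<Rightarrow> 'a \<Rightarrow> 'b) \<Rightarrow> bool" where
  "bilinear_map s t p \<longleftrightarrow>
     (\<forall>x. Vector_Spaces.linear s t (p x)) \<and> (\<forall>y. Vector_Spaces.linear s t (\<lambda>x. p x y))"

locale novikov_algebra = vector_space scale
  for scale :: "'k::field \<Rightarrow> 'a::ab_group_add \<Rightarrow> 'a" +
  fixes prd :: "'a \<Rightarrow> 'a \<Rightarrow> 'a"
  assumes prd_bilinear: "bilinear_map scale scale prd"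
    and left_symmetric:
      "prd (prd x y) z - prd x (prd y z) = prd (prd y x) z - prd y (prd x z)"
    and right_commutative: "prd (prd x y) z = prd (prd x z) y"

locale lie_algebra = vector_space scale
  for scale :: "'k::field \<Rightarrow> 'a::ab_group_add \<Rightarrow> 'a" +
  fixes br :: "'a \<Rightarrow> 'a \<Rightarrow> 'a"
  assumes br_bilinear: "bilinear_map scale scale br"
    and br_alternating: "br x x = 0"
    and br_jacobi: "br x (br y z) + br y (br z x) + br z (br x y) = 0"

locale gd_algebra = novikov_algebra scale prd + lie_algebra scale br
  for scale :: "'k::field \<Rightarrow> 'a::ab_group_add \<Rightarrow> 'a"
    and prd :: "'a \<Rightarrow> 'a \<Rightarrow> 'a"
    and br :: "'a \<Rightarrow> 'a \<Rightarrow> 'a" +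
  assumes gd_compatible:
    "br x (prd y z) - br z (prd y x) + prd (br y x) z - prd (br y z) x - prd y (br x z) = 0"

definition gd_products ::
    "('k::field \<Rightarrow> 'a::ab_group_add \<Rightarrow> 'a) \<Rightarrow> ('a \<Rightarrow> 'a \<Rightarrow> 'a) \<Rightarrow> ('a \<Rightarrow> 'a \<Rightarrow> 'a) set" where
  "gd_products s br = {p. gd_algebra s p br}"


section \<open>The Lie algebra of traceless complex 2 by 2 matrices\<close>

typedef sl2 = "{A :: complex^2^2. trace A = 0}"
  by (rule exI[of _ 0]) (simp add: trace_def)

setup_lifting type_definition_sl2

instantiation sl2 :: ab_group_add
begin

lift_definition zero_sl2 :: sl2 is 0 by (simp add: trace_def)
lift_definition plus_sl2 :: "sl2 \<Rightarrow> sl2 \<Rightarrow> sl2" is "(+)" by (simp add: trace_add)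
lift_definition minus_sl2 :: "sl2 \<Rightarrow> sl2 \<Rightarrow> sl2" is "(-)" by (simp add: trace_sub)
lift_definition uminus_sl2 :: "sl2 \<Rightarrow> sl2" is uminus by (simp add: trace_def sum_negf)

instance by standard (transfer; simp add: algebra_simps)+

end

lift_definition sl2_scale :: "complex \<Rightarrow> sl2 \<Rightarrow> sl2" is "\<lambda>c A. \<chi> i j. c * A $ i $ j"
  by (simp add: trace_def flip: sum_distrib_left)

lift_definition sl2_bracket :: "sl2 \<Rightarrow> sl2 \<Rightarrow> sl2" is "\<lambda>A B. A ** B - B ** A"
  by (metis trace_sub trace_mul_sym diff_self)

lift_definition sl2_e :: sl2 is "vector [vector [0, 1], vector [0, 0]]"
  by (simp add: trace_def sum_2)

lift_definition sl2_h :: sl2 is "vector [vector [1, 0], vector [0, -1]]"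
  by (simp add: trace_def sum_2)

lift_definition sl2_f :: sl2 is "vector [vector [0, 0], vector [1, 0]]"
  by (simp add: trace_def sum_2)

lemmas sl2_matrix_simps =
  vec_eq_iff forall_2 sum_2 matrix_matrix_mult_def trace_def

lemma sl2_vector_space: "vector_space sl2_scale"
  by standard (transfer; simp add: vec_eq_iff algebra_simps)+

lemma sl2_linearI:
  assumes "vector_space t"
    and "\<And>x y. f (x + y) = f x + f y" "\<And>c x. f (sl2_scale c x) = t c (f x)"
  shows "Vector_Spaces.linear sl2_scale t f"
  using assms sl2_vector_space
  by (simp add: Vector_Spaces.linear_def module_hom_def module_hom_axioms_def
      module_iff_vector_space)

lemma sl2_bracket_add_right: "sl2_bracket x (y + z) = sl2_bracket x y + sl2_bracket x z"
  by transfer (simp add: sl2_matrix_simps algebra_simps)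

lemma sl2_bracket_add_left: "sl2_bracket (x + y) z = sl2_bracket x z + sl2_bracket y z"
  by transfer (simp add: sl2_matrix_simps algebra_simps)

lemma sl2_bracket_scale_right: "sl2_bracket x (sl2_scale c y) = sl2_scale c (sl2_bracket x y)"
  by transfer (simp add: sl2_matrix_simps algebra_simps)

lemma sl2_bracket_scale_left: "sl2_bracket (sl2_scale c x) y = sl2_scale c (sl2_bracket x y)"
  by transfer (simp add: sl2_matrix_simps algebra_simps)

lemma sl2_bracket_self: "sl2_bracket x x = 0"
  by transfer simp

lemma sl2_jacobi:
  "sl2_bracket x (sl2_bracket y z) + sl2_bracket y (sl2_bracket z x)
    + sl2_bracket z (sl2_bracket x y) = 0"
  by transfer (simp add: sl2_matrix_simps algebra_simps)

lemma sl2_lie_algebra: "lie_algebra sl2_scale sl2_bracket"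
  unfolding lie_algebra_def lie_algebra_axioms_def bilinear_map_def
  by (intro conjI allI sl2_linearI sl2_vector_space sl2_bracket_add_left sl2_bracket_add_right
      sl2_bracket_scale_left sl2_bracket_scale_right sl2_bracket_self sl2_jacobi)

lemma sl2_brackets:
  "sl2_bracket sl2_h sl2_e = sl2_scale 2 sl2_e"
  "sl2_bracket sl2_h sl2_f = sl2_scale (-2) sl2_f"
  "sl2_bracket sl2_e sl2_f = sl2_h"
  by (transfer; simp add: sl2_matrix_simps)+

lemma sl2_basis:
  "\<exists>!t. x = sl2_scale (fst t) sl2_e + sl2_scale (fst (snd t)) sl2_h + sl2_scale (snd (snd t)) sl2_f"
proof -
  have eq: "x = sl2_scale a sl2_e + sl2_scale b sl2_h + sl2_scale c sl2_f \<longleftrightarrow>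
      a = Rep_sl2 x $ 1 $ 2 \<and> b = Rep_sl2 x $ 1 $ 1 \<and> c = Rep_sl2 x $ 2 $ 1" for a b c
    by transfer (auto simp: sl2_matrix_simps add_eq_0_iff)
  show ?thesis
    unfolding eq by (rule ex1I[of _ "(Rep_sl2 x $ 1 $ 2, Rep_sl2 x $ 1 $ 1, Rep_sl2 x $ 2 $ 1)"]) auto
qed


section \<open>Invariant forms and the products attached to isotropic elements\<close>

definition invariant_symmetric_form :: "(sl2 \<Rightarrow> sl2 \<Rightarrow> complex) \<Rightarrow> bool" where
  "invariant_symmetric_form B \<longleftrightarrow>
     bilinear_map sl2_scale (*) B \<and>
     (\<forall>x y. B x y = B y x) \<and>
     (\<forall>x y z. B (sl2_bracket x y) z = B x (sl2_bracket y z))"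

text \<open>The normalized invariant form exists: it is the trace form.\<close>

lift_definition sl2_trace_form :: "sl2 \<Rightarrow> sl2 \<Rightarrow> complex" is "\<lambda>A B. trace (A ** B)" .

lemma sl2_trace_form_add_right:
  "sl2_trace_form x (y + z) = sl2_trace_form x y + sl2_trace_form x z"
  by transfer (simp add: sl2_matrix_simps algebra_simps)

lemma sl2_trace_form_scale_right:
  "sl2_trace_form x (sl2_scale c y) = c * sl2_trace_form x y"
  by transfer (simp add: sl2_matrix_simps algebra_simps)

lemma sl2_trace_form_sym: "sl2_trace_form x y = sl2_trace_form y x"
  by transfer (rule trace_mul_sym)

lemma sl2_trace_form_invariant:
  "sl2_trace_form (sl2_bracket x y) z = sl2_trace_form x (sl2_bracket y z)"
  by transfer (simp add: sl2_matrix_simps algebra_simps)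

lemma sl2_trace_form:
  "invariant_symmetric_form sl2_trace_form"
  "sl2_trace_form sl2_e sl2_f = 1"
  "sl2_trace_form sl2_h sl2_h = 2"
proof -
  have vs: "vector_space ((*) :: complex \<Rightarrow> complex \<Rightarrow> complex)"
    by standard (simp_all add: algebra_simps)
  have lin: "Vector_Spaces.linear sl2_scale (*) (sl2_trace_form x)" for x
    by (intro sl2_linearI vs sl2_trace_form_add_right sl2_trace_form_scale_right)
  have "(\<lambda>x. sl2_trace_form x y) = sl2_trace_form y" for y
    using sl2_trace_form_sym by blast
  then have "bilinear_map sl2_scale (*) sl2_trace_form"
    unfolding bilinear_map_def using lin by simp
  then show "invariant_symmetric_form sl2_trace_form"
    unfolding invariant_symmetric_form_def
    using sl2_trace_form_sym sl2_trace_form_invariant by blast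
  show "sl2_trace_form sl2_e sl2_f = 1" "sl2_trace_form sl2_h sl2_h = 2"
    by (transfer, simp add: sl2_matrix_simps)+
qed

definition isotropic_cone :: "(sl2 \<Rightarrow> sl2 \<Rightarrow> complex) \<Rightarrow> sl2 set" where
  "isotropic_cone B = {u. B u u = 0}"

definition T_map :: "(sl2 \<Rightarrow> sl2 \<Rightarrow> complex) \<Rightarrow> sl2 \<Rightarrow> sl2 \<Rightarrow> sl2" where
  "T_map B u x = sl2_scale (B x u) u"

definition circ :: "(sl2 \<Rightarrow> sl2 \<Rightarrow> complex) \<Rightarrow> sl2 \<Rightarrow> sl2 \<Rightarrow> sl2 \<Rightarrow> sl2" where
  "circ B u x y = T_map B u (sl2_bracket x y) - sl2_bracket (T_map B u x) y"

definition sign_rel :: "(sl2 \<Rightarrow> sl2 \<Rightarrow> complex) \<Rightarrow> (sl2 \<times> sl2) set" where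
  "sign_rel B = {(u, v). u \<in> isotropic_cone B \<and> v \<in> isotropic_cone B \<and> (v = u \<or> v = - u)}"

end

theory Submission
  imports Defs
begin

text \<open>
  Let \<open>R\<^sub>y\<close> denote right multiplication by \<open>y\<close> in a product on \<open>sl2\<close>. The compatibility
  identity of a Gelfand--Dorfman algebra says exactly that \<open>y \<mapsto> R\<^sub>y\<close> is a 1-cocycle of \<open>sl2\<close> with
  values in \<open>End(sl2)\<close>. By Whitehead's first lemma (\<open>whitehead_cocycle_is_coboundary\<close>) it is a
  coboundary, \<open>R\<^sub>y = [ad y, T]\<close>, which unfolds to \<open>x \<circ> y = T[x,y] - [T x,y]\<close>. Conversely every linear
  \<open>T\<close> gives a compatible product (\<open>coboundary_product_cocycle\<close>), so the classification becomes a
  question about the endomorphism \<open>T\<close>, which matters modulo scalars only.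

  Decompose \<open>T\<close> modulo scalars as \<open>ad a + S\<close> with \<open>S\<close> self-adjoint and traceless, that is, a binary
  quartic (\<open>endomorphism_decomposition\<close>). Right commutativity of the product means that all the
  operators \<open>[ad y, T]\<close> commute. These quadratic equations force \<open>a = 0\<close> and put \<open>S\<close> on the cone over
  the rational normal quartic curve (\<open>right_commutative_endomorphism\<close>). Over the complex numbers the
  points of this cone are exactly the maps \<open>x \<mapsto> B(x,u) u\<close> with \<open>u\<close> isotropic
  (\<open>veronese_parametrization\<close>), and therefore the product is \<open>\<circ>\<^sub>u\<close>.

  In the other direction, isotropy of \<open>u\<close> gives \<open>[u,[u,y]] = - 2 B(y,u) u\<close>. It follows that
  \<open>(x \<circ>\<^sub>u y) \<circ>\<^sub>u z\<close> and \<open>x \<circ>\<^sub>u (y \<circ>\<^sub>u z)\<close> are the multiples of \<open>u\<close> by \<open>2\<close> and by \<open>- 4\<close> times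
  \<open>B(x,u) B(y,u) B(z,u)\<close> (\<open>circ_circ_left\<close>, \<open>circ_circ_right\<close>), so the Novikov identities hold by
  symmetry. Finally \<open>\<circ>\<^sub>u\<close> depends on \<open>u\<close> only through the products of two of its coordinates and
  determines these products, whence \<open>u\<close> is unique up to sign (\<open>circ_eq_iff\<close>).
\<close>

section \<open>Coordinates\<close>

text \<open>Coordinates with respect to the basis \<open>e, h, f\<close>.\<close>

lift_definition ce :: "sl2 \<Rightarrow> complex" is "\<lambda>A. A $ 1 $ 2" .
lift_definition ch :: "sl2 \<Rightarrow> complex" is "\<lambda>A. A $ 1 $ 1" .
lift_definition cf :: "sl2 \<Rightarrow> complex" is "\<lambda>A. A $ 2 $ 1" .

lemma sl2_eq_iff: "x = y \<longleftrightarrow> ce x = ce y \<and> ch x = ch y \<and> cf x = cf y"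
  by transfer (auto simp: sl2_matrix_simps add_eq_0_iff)

lemma coord_simps [simp]:
  "ce 0 = 0" "ch 0 = 0" "cf 0 = 0"
  "ce (x + y) = ce x + ce y" "ch (x + y) = ch x + ch y" "cf (x + y) = cf x + cf y"
  "ce (x - y) = ce x - ce y" "ch (x - y) = ch x - ch y" "cf (x - y) = cf x - cf y"
  "ce (- x) = - ce x" "ch (- x) = - ch x" "cf (- x) = - cf x"
  "ce (sl2_scale k x) = k * ce x" "ch (sl2_scale k x) = k * ch x" "cf (sl2_scale k x) = k * cf x"
  "ce sl2_e = 1" "ch sl2_e = 0" "cf sl2_e = 0"
  "ce sl2_h = 0" "ch sl2_h = 1" "cf sl2_h = 0"
  "ce sl2_f = 0" "ch sl2_f = 0" "cf sl2_f = 1"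
  by (transfer; simp)+

lemma coord_bracket [simp]:
  "ce (sl2_bracket x y) = 2 * (ch x * ce y - ce x * ch y)"
  "ch (sl2_bracket x y) = ce x * cf y - cf x * ce y"
  "cf (sl2_bracket x y) = 2 * (cf x * ch y - ch x * cf y)"
  by (transfer; simp add: sl2_matrix_simps add_eq_0_iff algebra_simps)+

definition sl2_of :: "complex \<Rightarrow> complex \<Rightarrow> complex \<Rightarrow> sl2" where
  "sl2_of a b c = sl2_scale a sl2_e + sl2_scale b sl2_h + sl2_scale c sl2_f"

lemma coord_sl2_of [simp]: "ce (sl2_of a b c) = a" "ch (sl2_of a b c) = b" "cf (sl2_of a b c) = c"
  by (simp_all add: sl2_of_def)

lemma sl2_of_coords: "sl2_of (ce x) (ch x) (cf x) = x"
  by (simp add: sl2_eq_iff)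

section \<open>Linear and bilinear maps, and the invariant form\<close>

lemma linearD:
  assumes "Vector_Spaces.linear s t g"
  shows "g (x + y) = g x + g y" and "g (s c x) = t c (g x)"
proof -
  interpret Vector_Spaces.linear s t g by fact
  show "g (x + y) = g x + g y" "g (s c x) = t c (g x)" by (rule add, rule scale)
qed

lemma bilinearD:
  assumes "bilinear_map s t p"
  shows "p (x + y) z = p x z + p y z" and "p x (y + z) = p x y + p x z"
    and "p (s c x) y = t c (p x y)" and "p x (s c y) = t c (p x y)"
  using assms by (auto simp: bilinear_map_def dest: linearD)

lemma bilinear_on_basis:
  assumes "bilinear_map sl2_scale t p"
  shows "p x y =
    t (ce y) (t (ce x) (p sl2_e sl2_e) + t (ch x) (p sl2_h sl2_e) + t (cf x) (p sl2_f sl2_e))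
    + t (ch y) (t (ce x) (p sl2_e sl2_h) + t (ch x) (p sl2_h sl2_h) + t (cf x) (p sl2_f sl2_h))
    + t (cf y) (t (ce x) (p sl2_e sl2_f) + t (ch x) (p sl2_h sl2_f) + t (cf x) (p sl2_f sl2_f))"
proof -
  have "p x y = p (sl2_of (ce x) (ch x) (cf x)) (sl2_of (ce y) (ch y) (cf y))"
    by (simp add: sl2_of_coords)
  then show ?thesis
    by (simp add: sl2_of_def bilinearD[OF assms])
qed

lemma sl2_endomorphismI:
  assumes "\<And>x y. g (x + y) = g x + g y" "\<And>c x. g (sl2_scale c x) = sl2_scale c (g x)"
  shows "Vector_Spaces.linear sl2_scale sl2_scale g"
  using assms by (intro sl2_linearI sl2_vector_space)

lemma trace_form_coords:
  "sl2_trace_form x y = ce x * cf y + cf x * ce y + 2 * ch x * ch y"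
  by transfer (simp add: sl2_matrix_simps add_eq_0_iff algebra_simps)

text \<open>Moving \<open>h\<close> across the form by invariance shows that weight vectors pair to zero unless
  their weights cancel, so the form is determined by \<open>B e f\<close> and \<open>B h h\<close>.\<close>

lemma invariant_form_unique:
  assumes inv: "invariant_symmetric_form B" and ef: "B sl2_e sl2_f = 1" and hh: "B sl2_h sl2_h = 2"
  shows "B = sl2_trace_form"
proof (intro ext)
  fix x y
  have bil: "bilinear_map sl2_scale (*) B" and sym: "B x y = B y x"
    and ass: "B (sl2_bracket x y) z = B x (sl2_bracket y z)" for x y z
    using inv by (auto simp: invariant_symmetric_form_def)
  note b = bilinearD[OF bil]
  have br: "sl2_bracket sl2_h sl2_h = sl2_scale 0 sl2_h"
    "sl2_bracket sl2_e sl2_e = sl2_scale 0 sl2_h" "sl2_bracket sl2_f sl2_f = sl2_scale 0 sl2_h"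
    by (simp_all add: sl2_eq_iff)
  have ee: "B sl2_e sl2_e = 0" using ass[of sl2_h sl2_e sl2_e] by (simp add: sl2_brackets b br)
  have fff: "B sl2_f sl2_f = 0" using ass[of sl2_h sl2_f sl2_f] by (simp add: sl2_brackets b br)
  have eh: "B sl2_e sl2_h = 0" using ass[of sl2_h sl2_h sl2_e] by (simp add: sl2_brackets b br sym)
  have fh: "B sl2_f sl2_h = 0" using ass[of sl2_h sl2_h sl2_f] by (simp add: sl2_brackets b br sym)
  show "B x y = sl2_trace_form x y"
    by (subst bilinear_on_basis[OF bil])
      (simp add: trace_form_coords ef hh ee fff eh fh sym[of sl2_f sl2_e] sym[of sl2_h sl2_e]
        sym[of sl2_h sl2_f] algebra_simps)
qed

abbreviation \<kappa> :: "sl2 \<Rightarrow> sl2 \<Rightarrow> complex" where "\<kappa> \<equiv> sl2_trace_form"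

section \<open>Coboundaries and the compatibility condition\<close>

text \<open>For a linear \<open>T\<close>, right multiplication by \<open>y\<close> in this product is the commutator of \<open>ad y\<close>
  with \<open>T\<close>, that is, the value at \<open>y\<close> of the coboundary of \<open>T\<close> in \<open>End(sl2)\<close>.\<close>

definition coboundary_product :: "(sl2 \<Rightarrow> sl2) \<Rightarrow> sl2 \<Rightarrow> sl2 \<Rightarrow> sl2" where
  "coboundary_product T x y = T (sl2_bracket x y) - sl2_bracket (T x) y"

lemma circ_coboundary: "circ B u = coboundary_product (T_map B u)"
  by (intro ext) (simp add: circ_def coboundary_product_def)

lemma coboundary_product_bilinear:
  assumes "Vector_Spaces.linear sl2_scale sl2_scale T"
  shows "bilinear_map sl2_scale sl2_scale (coboundary_product T)"
  unfolding bilinear_map_def coboundary_product_def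
  by (intro conjI allI sl2_endomorphismI)
    (simp_all add: linearD[OF assms] sl2_bracket_add_left sl2_bracket_add_right sl2_eq_iff
      sl2_bracket_scale_left sl2_bracket_scale_right algebra_simps)

lemma linear_diff:
  assumes "Vector_Spaces.linear s t T"
  shows "T (x - y) = T x - T y"
proof -
  interpret Vector_Spaces.linear s t T by fact
  show ?thesis by (rule diff)
qed

text \<open>The Gelfand--Dorfman compatibility identity. Written with the right multiplications
  \<open>R\<^sub>z y = p y z\<close> it reads \<open>[ad x, R\<^sub>z] - [ad z, R\<^sub>x] = R\<close>\<open>\<^bsub>[x,z]\<^esub>\<close>, which is the
  1-cocycle condition for \<open>z \<mapsto> R\<^sub>z\<close> with values in \<open>End(sl2)\<close>.\<close>

definition gd_cocycle :: "(sl2 \<Rightarrow> sl2 \<Rightarrow> sl2) \<Rightarrow> bool" where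
  "gd_cocycle p \<longleftrightarrow> (\<forall>x y z. sl2_bracket x (p y z) - sl2_bracket z (p y x)
     + p (sl2_bracket y x) z - p (sl2_bracket y z) x - p y (sl2_bracket x z) = 0)"

text \<open>The terms in which \<open>T\<close> is applied last form the image under \<open>T\<close> of an instance of the Jacobi
  identity. The remaining terms involve \<open>T\<close> only through \<open>T y\<close>, \<open>T[y,x]\<close> and \<open>T[y,z]\<close>, and cancel
  whatever these three vectors are.\<close>

lemma coboundary_product_cocycle:
  assumes T: "Vector_Spaces.linear sl2_scale sl2_scale T"
  shows "gd_cocycle (coboundary_product T)"
  unfolding gd_cocycle_def
proof (intro allI)
  fix x y z
  have "T (sl2_bracket (sl2_bracket y x) z - sl2_bracket (sl2_bracket y z) x
      - sl2_bracket y (sl2_bracket x z)) = T 0"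
    by (rule arg_cong[of _ _ T]) (simp add: sl2_eq_iff algebra_simps)
  moreover have "T 0 = 0" using linear_diff[OF T, of 0 0] by simp
  ultimately have "T (sl2_bracket (sl2_bracket y x) z) - T (sl2_bracket (sl2_bracket y z) x)
      - T (sl2_bracket y (sl2_bracket x z)) = 0"
    by (simp add: linear_diff[OF T])
  moreover have "sl2_bracket x (b - sl2_bracket c z) - sl2_bracket z (a - sl2_bracket c x)
      - sl2_bracket a z + sl2_bracket b x + sl2_bracket c (sl2_bracket x z) = 0" for a b c
    by (simp add: sl2_eq_iff algebra_simps)
  from this[of "T (sl2_bracket y z)" "T y" "T (sl2_bracket y x)"]
  have "sl2_bracket x (coboundary_product T y z) - sl2_bracket z (coboundary_product T y x)
      - sl2_bracket (T (sl2_bracket y x)) z + sl2_bracket (T (sl2_bracket y z)) x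
      + sl2_bracket (T y) (sl2_bracket x z) = 0"
    by (simp add: coboundary_product_def)
  ultimately show "sl2_bracket x (coboundary_product T y z)
      - sl2_bracket z (coboundary_product T y x)
      + coboundary_product T (sl2_bracket y x) z - coboundary_product T (sl2_bracket y z) x
      - coboundary_product T y (sl2_bracket x z) = 0"
    unfolding coboundary_product_def[of T "sl2_bracket _ _"]
      coboundary_product_def[of T _ "sl2_bracket x z"]
    by (simp add: algebra_simps)
qed

lemma bilinear_eqI_basis:
  assumes "bilinear_map sl2_scale t p" "bilinear_map sl2_scale t q"
    and "\<forall>x\<in>{sl2_e, sl2_h, sl2_f}. \<forall>y\<in>{sl2_e, sl2_h, sl2_f}. p x y = q x y"
  shows "p = q"
proof (intro ext)
  fix x y
  show "p x y = q x y"
    unfolding bilinear_on_basis[OF assms(1), of x y] bilinear_on_basis[OF assms(2), of x y]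
    using assms(3) by simp
qed

text \<open>An instance of Whitehead's first lemma: \<open>H\<^sup>1(sl2, End(sl2))\<close> vanishes. The endomorphism is read off
  from the weights: since \<open>ad h\<close> is diagonal, the off-diagonal entries of \<open>T\<close> are those of
  \<open>R\<^sub>h = [ad h, T]\<close> divided by a difference of weights. The diagonal of \<open>T\<close>, normalized to vanish at
  \<open>h\<close>, is recovered from \<open>R\<^sub>e\<close>. The nine cocycle equations on basis vectors then express all
  27 structure constants of \<open>p\<close> through the eight used to define \<open>T\<close>.\<close>

lemma whitehead_cocycle_is_coboundary:
  assumes bil: "bilinear_map sl2_scale sl2_scale p" and coc: "gd_cocycle p"
  obtains T where "Vector_Spaces.linear sl2_scale sl2_scale T" "p = coboundary_product T"
proof -
  note b = bilinearD[OF bil]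
  have br: "sl2_bracket sl2_e sl2_h = sl2_scale (-2) sl2_e"
    "sl2_bracket sl2_f sl2_h = sl2_scale 2 sl2_f" "sl2_bracket sl2_f sl2_e = sl2_scale (-1) sl2_h"
    "sl2_bracket sl2_h sl2_h = sl2_scale 0 sl2_h"
    "sl2_bracket sl2_e sl2_e = sl2_scale 0 sl2_h" "sl2_bracket sl2_f sl2_f = sl2_scale 0 sl2_h"
    by (simp_all add: sl2_eq_iff)
  define T where "T x =
    sl2_scale (ce x) (sl2_of (ce (p sl2_h sl2_e) / 2) (- ch (p sl2_e sl2_h) / 2) (- cf (p sl2_e sl2_h) / 4))
    + sl2_scale (ch x) (sl2_of (ce (p sl2_h sl2_h) / 2) 0 (- cf (p sl2_h sl2_h) / 2))
    + sl2_scale (cf x) (sl2_of (ce (p sl2_f sl2_h) / 4) (ch (p sl2_f sl2_h) / 2) (ch (p sl2_f sl2_e)))" for x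
  have T: "Vector_Spaces.linear sl2_scale sl2_scale T"
    by (intro sl2_endomorphismI) (simp_all add: T_def sl2_eq_iff add_divide_distrib algebra_simps)
  have coc_eq: "sl2_bracket x (p y z) - sl2_bracket z (p y x)
     + p (sl2_bracket y x) z - p (sl2_bracket y z) x - p y (sl2_bracket x z) = 0" for x y z
    using coc by (auto simp: gd_cocycle_def)
  \<comment> \<open>The cocycle condition is alternating in its outer arguments, so three pairs suffice.\<close>
  note coc_basis = coc_eq[of sl2_h sl2_e sl2_e] coc_eq[of sl2_h sl2_h sl2_e] coc_eq[of sl2_h sl2_f sl2_e]
    coc_eq[of sl2_h sl2_e sl2_f] coc_eq[of sl2_h sl2_h sl2_f] coc_eq[of sl2_h sl2_f sl2_f]
    coc_eq[of sl2_e sl2_e sl2_f] coc_eq[of sl2_e sl2_h sl2_f] coc_eq[of sl2_e sl2_f sl2_f]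
  note eqs = coc_basis[THEN arg_cong[where f = ce]] coc_basis[THEN arg_cong[where f = ch]]
    coc_basis[THEN arg_cong[where f = cf]]
  note eqs = eqs[simplified sl2_brackets br b coord_simps coord_bracket, simplified]
  \<comment> \<open>The diagonal of \<open>R\<^sub>h\<close>: its three entries agree and add up to zero.\<close>
  have "ch (p sl2_h sl2_h) + ce (p sl2_e sl2_h) + cf (p sl2_f sl2_h) = 0"
    unfolding eqs(7)[symmetric] eqs(17)[symmetric] eqs(27)[symmetric] by simp
  then have hh: "ch (p sl2_h sl2_h) = 0" by (simp add: eqs(13,23))
  have ce_p: "ce (p sl2_e sl2_e) = ch (p sl2_e sl2_h)" "ce (p sl2_e sl2_h) = 0"
    "ce (p sl2_e sl2_f) = ce (p sl2_h sl2_h) / 2" "ce (p sl2_h sl2_f) = - ce (p sl2_f sl2_h) / 2"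
    "ce (p sl2_f sl2_e) = - ch (p sl2_f sl2_h) - ce (p sl2_h sl2_h) / 2" "ce (p sl2_f sl2_f) = 0"
    subgoal by (rule eqs(1)[symmetric])
    subgoal by (simp add: eqs(13) hh)
    subgoal using eqs(4) by (simp add: complex_eq_iff)
    subgoal using eqs(5) by (simp add: complex_eq_iff)
    subgoal using eqs(3) by (simp add: complex_eq_iff)
    by (rule eqs(6))
  have ch_p: "ch (p sl2_e sl2_e) = - cf (p sl2_e sl2_h) / 4"
    "ch (p sl2_e sl2_f) = - ce (p sl2_h sl2_e) / 2"
    "ch (p sl2_h sl2_e) = - cf (p sl2_h sl2_h) / 2 - ch (p sl2_e sl2_h)"
    "ch (p sl2_h sl2_h) = 0"
    "ch (p sl2_h sl2_f) = - ce (p sl2_h sl2_h) / 2 - ch (p sl2_f sl2_h)"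
    "ch (p sl2_f sl2_f) = - ce (p sl2_f sl2_h) / 4"
    subgoal using eqs(10) by (simp add: complex_eq_iff)
    subgoal using eqs(7) ce_p(2) by (simp add: complex_eq_iff)
    subgoal using eqs(11) by (simp add: complex_eq_iff)
    subgoal by (rule hh)
    subgoal using eqs(14) by (simp add: complex_eq_iff)
    using eqs(15) by (simp add: complex_eq_iff)
  have cf_p: "cf (p sl2_e sl2_e) = 0" "cf (p sl2_e sl2_f) = - ch (p sl2_e sl2_h) - cf (p sl2_h sl2_h) / 2"
    "cf (p sl2_h sl2_e) = - cf (p sl2_e sl2_h) / 2" "cf (p sl2_h sl2_f) = - 2 * ch (p sl2_f sl2_e)"
    "cf (p sl2_f sl2_e) = cf (p sl2_h sl2_h) / 2" "cf (p sl2_f sl2_h) = 0"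
    "cf (p sl2_f sl2_f) = ch (p sl2_f sl2_h)"
    subgoal by (rule eqs(19))
    subgoal using eqs(22) by (simp add: complex_eq_iff)
    subgoal using eqs(20) by (simp add: complex_eq_iff)
    subgoal using eqs(27) eqs(23) hh by (simp add: complex_eq_iff)
    subgoal by (simp add: eqs(21))
    subgoal by (simp add: eqs(23) hh)
    by (rule eqs(24))
  have "\<forall>x\<in>{sl2_e, sl2_h, sl2_f}. \<forall>y\<in>{sl2_e, sl2_h, sl2_f}. p x y = coboundary_product T x y"
    by (simp add: coboundary_product_def T_def sl2_eq_iff ce_p ch_p cf_p add_divide_distrib)
  then have "p = coboundary_product T"
    by (rule bilinear_eqI_basis[OF bil coboundary_product_bilinear[OF T]])
  with T show ?thesis by (rule that)
qed

section \<open>Endomorphisms whose right multiplications commute\<close>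

text \<open>The traceless endomorphisms that are self-adjoint for the trace form make up the
  five-dimensional irreducible representation, the binary quartics. The entries \<open>s0, \<dots>, s4\<close> are
  scaled so that for isotropic \<open>u\<close> with coordinates \<open>\<alpha>, \<beta>, \<gamma>\<close>, where \<open>\<beta>\<^sup>2 = - \<alpha>\<gamma>\<close>, the map
  \<open>x \<mapsto> B(x,u) u\<close> has the entries \<open>\<gamma>\<^sup>2, \<beta>\<gamma>, - \<alpha>\<gamma>, \<alpha>\<beta>, \<alpha>\<^sup>2\<close>.\<close>

definition quartic_map ::
    "complex \<Rightarrow> complex \<Rightarrow> complex \<Rightarrow> complex \<Rightarrow> complex \<Rightarrow> sl2 \<Rightarrow> sl2" where
  "quartic_map s0 s1 s2 s3 s4 x =
     sl2_of (s4 * cf x + 2 * s3 * ch x - s2 * ce x)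
            (s3 * cf x + 2 * s2 * ch x + s1 * ce x)
            (s0 * ce x + 2 * s1 * ch x - s2 * cf x)"

text \<open>The splitting of \<open>End(sl2)\<close> into irreducibles: scalars, the skew-adjoint endomorphisms, all
  of which are inner derivations, and the quartics.\<close>

lemma endomorphism_decomposition:
  assumes T: "Vector_Spaces.linear sl2_scale sl2_scale T"
  obtains k a s0 s1 s2 s3 s4 where
    "\<And>x. T x = sl2_scale k x + (sl2_bracket a x + quartic_map s0 s1 s2 s3 s4 x)"
proof -
  define k where "k = (ce (T sl2_e) + ch (T sl2_h) + cf (T sl2_f)) / 3"
  define a where "a = sl2_of ((2 * ch (T sl2_f) - ce (T sl2_h)) / 4)
    ((ce (T sl2_e) - cf (T sl2_f)) / 4) ((cf (T sl2_h) - 2 * ch (T sl2_e)) / 4)"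
  have "T x = sl2_scale k x + (sl2_bracket a x + quartic_map (cf (T sl2_e))
      ((2 * ch (T sl2_e) + cf (T sl2_h)) / 4) ((ch (T sl2_h) - k) / 2)
      ((ce (T sl2_h) + 2 * ch (T sl2_f)) / 4) (ce (T sl2_f)) x)" for x
  proof -
    have "T x = T (sl2_of (ce x) (ch x) (cf x))" by (simp add: sl2_of_coords)
    then show ?thesis
      by (simp add: sl2_of_def[of "ce x"] linearD[OF T] sl2_eq_iff quartic_map_def k_def a_def field_simps)
  qed
  then show ?thesis by (rule that)
qed

lemma coboundary_product_mod_scalars:
  assumes "\<And>x. T x = sl2_scale k x + T' x"
  shows "coboundary_product T = coboundary_product T'"
  by (intro ext) (simp add: coboundary_product_def assms sl2_bracket_add_left sl2_bracket_scale_left)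

text \<open>Right commutativity says that the operators \<open>[ad y, T]\<close> commute with each other. For
  \<open>T = ad a + S\<close> their commutators have a self-adjoint part, bilinear in \<open>a\<close> and \<open>S\<close>, and a
  skew-adjoint part, quadratic in \<open>a\<close> plus quadratic in \<open>S\<close>. The bilinear part is a triangular system
  that forces \<open>S = 0\<close> as soon as some coordinate of \<open>a\<close> is nonzero; the quadratic part then gives
  \<open>a = 0\<close> in every case. What is left are quadrics that cut out the cone over the rational normal
  quartic curve.\<close>

lemma right_commutative_endomorphism:
  fixes a s0 s1 s2 s3 s4
  defines "p \<equiv> coboundary_product (\<lambda>x. sl2_bracket a x + quartic_map s0 s1 s2 s3 s4 x)"
  assumes rc: "\<And>x y z. p (p x y) z = p (p x z) y"
  shows "a = 0" and "s2 * s4 = s3\<^sup>2" and "s1 * s4 = - (s2 * s3)" and "s0 * s4 = s2\<^sup>2"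
    and "s0 * s2 = s1\<^sup>2"
proof -
  note p_simps = p_def coboundary_product_def quartic_map_def
  have eeh: "ch (p (p sl2_e sl2_e) sl2_h) = ch (p (p sl2_e sl2_h) sl2_e)"
    "cf (p (p sl2_e sl2_e) sl2_h) = cf (p (p sl2_e sl2_h) sl2_e)"
    and eef: "ce (p (p sl2_e sl2_e) sl2_f) = ce (p (p sl2_e sl2_f) sl2_e)"
    "ch (p (p sl2_e sl2_e) sl2_f) = ch (p (p sl2_e sl2_f) sl2_e)"
    "cf (p (p sl2_e sl2_e) sl2_f) = cf (p (p sl2_e sl2_f) sl2_e)"
    and ehf: "ce (p (p sl2_e sl2_h) sl2_f) = ce (p (p sl2_e sl2_f) sl2_h)"
    "ch (p (p sl2_e sl2_h) sl2_f) = ch (p (p sl2_e sl2_f) sl2_h)"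
    "cf (p (p sl2_e sl2_h) sl2_f) = cf (p (p sl2_e sl2_f) sl2_h)"
    and heh: "ch (p (p sl2_h sl2_e) sl2_h) = ch (p (p sl2_h sl2_h) sl2_e)"
    and hef: "ce (p (p sl2_h sl2_e) sl2_f) = ce (p (p sl2_h sl2_f) sl2_e)"
      "ch (p (p sl2_h sl2_e) sl2_f) = ch (p (p sl2_h sl2_f) sl2_e)"
      "cf (p (p sl2_h sl2_e) sl2_f) = cf (p (p sl2_h sl2_f) sl2_e)"
    and hhf: "ce (p (p sl2_h sl2_h) sl2_f) = ce (p (p sl2_h sl2_f) sl2_h)"
      "ch (p (p sl2_h sl2_h) sl2_f) = ch (p (p sl2_h sl2_f) sl2_h)"
      "cf (p (p sl2_h sl2_h) sl2_f) = cf (p (p sl2_h sl2_f) sl2_h)"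
    and feh: "ce (p (p sl2_f sl2_e) sl2_h) = ce (p (p sl2_f sl2_h) sl2_e)"
    and fef: "ce (p (p sl2_f sl2_e) sl2_f) = ce (p (p sl2_f sl2_f) sl2_e)"
      "ch (p (p sl2_f sl2_e) sl2_f) = ch (p (p sl2_f sl2_f) sl2_e)"
    and fhf: "ce (p (p sl2_f sl2_h) sl2_f) = ce (p (p sl2_f sl2_f) sl2_h)"
    by (simp_all only: rc)
  note eeh = eeh[unfolded p_simps, simplified] and eef = eef[unfolded p_simps, simplified]
    and ehf = ehf[unfolded p_simps, simplified] and heh = heh[unfolded p_simps, simplified]
    and hef = hef[unfolded p_simps, simplified] and hhf = hhf[unfolded p_simps, simplified]
    and feh = feh[unfolded p_simps, simplified] and fef = fef[unfolded p_simps, simplified]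
    and fhf = fhf[unfolded p_simps, simplified]
  \<comment> \<open>Ten bilinear equations, read off from coordinates and from combinations of coordinates in
    which the terms quadratic in the entries of \<open>S\<close> cancel.\<close>
  have f0: "cf a * s0 = 0" using eeh(2) by algebra
  have e4: "ce a * s4 = 0" using fhf by algebra
  have h2: "ch a * s2 = 0" using hef(2) by algebra
  have h0: "ch a * s0 = - 2 * cf a * s1" using eef(3) by algebra
  have h4: "ch a * s4 = - 2 * ce a * s3" using fef(1) by algebra
  have "- 2 * (ce a * s0) - 2 * (ch a * s1) + 3 * (cf a * s2) = 0"
    and "ce a * s0 - 2 * (ch a * s1) - 3 * (cf a * s2) = 0"
    and "ce a * s0 + 10 * (ch a * s1) + 3 * (cf a * s2) = 0"
    using ehf(3) heh eef(2) hef(3) by algebra+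
  then have e0: "ce a * s0 = 2 * cf a * s2" and h1: "ch a * s1 = - cf a * s2 / 2" by algebra+
  have "- 3 * (ce a * s2) - 2 * (ch a * s3) + cf a * s4 = 0"
    and "3 * (ce a * s2) - 2 * (ch a * s3) - 2 * (cf a * s4) = 0"
    and "3 * (ce a * s2) + 10 * (ch a * s3) + cf a * s4 = 0"
    using hhf(2) feh hef(1) fef(2) by algebra+
  then have f4: "cf a * s4 = 2 * ce a * s2" and h3: "ch a * s3 = - ce a * s2 / 2" by algebra+
  have f3: "cf a * s3 = - ce a * s1" using ehf(2) hhf(3) by algebra
  \<comment> \<open>Quadratic equations: in the absence of \<open>S\<close> they make every coordinate of \<open>a\<close> vanish.\<close>
  have ee: "(ce a)\<^sup>2 = 3 * (s2 * s4 - s3\<^sup>2)" using hhf(1) h4 by algebra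
  have ff: "(cf a)\<^sup>2 = 3 * (s0 * s2 - s1\<^sup>2)" using eeh(1) h0 by algebra
  have hh: "8 * (ch a)\<^sup>2 = 2 * s0 * s4 - 16 * s1 * s3 - 18 * s2\<^sup>2" using eef(1) h2 by algebra
  have "s0 = 0 \<and> s1 = 0 \<and> s2 = 0 \<and> s3 = 0 \<and> s4 = 0" if "a \<noteq> 0"
  proof -
    from that consider "ce a \<noteq> 0" | "cf a \<noteq> 0" | "ce a = 0" "cf a = 0" "ch a \<noteq> 0"
      by (auto simp: sl2_eq_iff)
    then show ?thesis
    proof cases
      case 1
      then have "s4 = 0" using e4 by simp
      moreover from this 1 have "s3 = 0" using h4 by simp
      moreover from this 1 have "s2 = 0" using h3 by simp
      moreover from this 1 have "s0 = 0" using e0 by simp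
      ultimately show ?thesis using f3 1 by simp
    next
      case 2
      then have "s0 = 0" using f0 by simp
      moreover from this 2 have "s1 = 0" using h0 by simp
      moreover from this 2 have "s2 = 0" using h1 by simp
      moreover from this 2 have "s3 = 0" using f3 \<open>s1 = 0\<close> by simp
      ultimately show ?thesis using f4 2 by simp
    next
      case 3
      then show ?thesis using h0 h1 h2 h3 h4 by simp
    qed
  qed
  then show a: "a = 0" using ee ff hh by (cases "a = 0") (simp_all add: sl2_eq_iff)
  show "s2 * s4 = s3\<^sup>2" "s0 * s2 = s1\<^sup>2" using ee ff by (simp_all add: a)
  show "s1 * s4 = - (s2 * s3)" using ehf(1) unfolding a coord_simps by algebra
  have "s0 * s4 = - (s1 * s3)" using ehf(2) unfolding a coord_simps by algebra
  moreover have "2 * s0 * s4 - 16 * s1 * s3 - 18 * s2\<^sup>2 = 0" using hh by (simp add: a)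
  ultimately show "s0 * s4 = s2\<^sup>2" by algebra
qed

text \<open>A point on the cone over the rational normal curve is a fourth power of a linear form, hence
  the square of a quadratic form of discriminant zero. The coordinates of that quadratic form are
  found by dividing by a square root of \<open>s4\<close>, except at the points where only \<open>s0\<close> survives.\<close>

lemma veronese_parametrization:
  fixes s0 s1 s2 s3 s4 :: complex
  assumes "s2 * s4 = s3\<^sup>2" and "s1 * s4 = - (s2 * s3)" and "s0 * s4 = s2\<^sup>2"
    and "s0 * s2 = s1\<^sup>2"
  obtains \<alpha> \<beta> \<gamma> where "\<beta>\<^sup>2 = - (\<alpha> * \<gamma>)" "s4 = \<alpha>\<^sup>2" "s3 = \<alpha> * \<beta>" "s2 = - (\<alpha> * \<gamma>)"
    "s1 = \<beta> * \<gamma>" "s0 = \<gamma>\<^sup>2"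
proof (cases "s4 = 0")
  case True
  then have "s3 = 0" "s2 = 0" "s1 = 0" using assms by auto
  with True show ?thesis by (intro that[of 0 0 "csqrt s0"]) auto
next
  case False
  define \<alpha> where "\<alpha> = csqrt s4"
  have s4: "s4 = \<alpha>\<^sup>2" by (simp add: \<alpha>_def)
  with False have "\<alpha> \<noteq> 0" by auto
  show ?thesis
  proof (rule that[of "s3 / \<alpha>" \<alpha> "- s2 / \<alpha>"])
    show "(s3 / \<alpha>)\<^sup>2 = - (\<alpha> * (- s2 / \<alpha>))" "s0 = (- s2 / \<alpha>)\<^sup>2" "s1 = s3 / \<alpha> * (- s2 / \<alpha>)"
      using assms \<open>\<alpha> \<noteq> 0\<close> unfolding s4 by (simp_all add: field_simps power2_eq_square)
  qed (use s4 \<open>\<alpha> \<noteq> 0\<close> in auto)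
qed

section \<open>The products attached to isotropic elements\<close>

lemma quartic_map_isotropic:
  assumes iso: "\<beta>\<^sup>2 = - (\<alpha> * \<gamma>)"
  shows "quartic_map (\<gamma>\<^sup>2) (\<beta> * \<gamma>) (- (\<alpha> * \<gamma>)) (\<alpha> * \<beta>) (\<alpha>\<^sup>2) x = T_map \<kappa> (sl2_of \<alpha> \<beta> \<gamma>) x"
proof -
  have "\<alpha> * (\<gamma> * t) = - (\<beta> * (\<beta> * t))" for t
    using arg_cong[OF iso[symmetric], of "\<lambda>c. - c * t"] by (simp add: power2_eq_square mult_ac)
  \<comment> \<open>Needed in the middle coordinate, where \<open>B(x,u) \<beta>\<close> contains \<open>\<beta>\<^sup>2\<close>.\<close>
  note this [simp]
  show ?thesis
    by (simp add: quartic_map_def T_map_def trace_form_coords sl2_eq_iff power2_eq_square algebra_simps)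
qed

text \<open>An isotropic element is a nilpotent matrix of rank at most one, so \<open>u\<^sup>2 = 0\<close> and
  \<open>u y u = tr(y u) u\<close>; hence the double commutator is \<open>- 2 u y u\<close>.\<close>

lemma isotropic_bracket_bracket:
  assumes "\<kappa> u u = 0"
  shows "sl2_bracket u (sl2_bracket u y) = sl2_scale (- 2 * \<kappa> y u) u"
proof -
  have "ce u * cf u = - (ch u)\<^sup>2" using assms unfolding trace_form_coords by algebra
  then show ?thesis
    unfolding sl2_eq_iff coord_simps coord_bracket trace_form_coords
    by (intro conjI; algebra)
qed

lemma form_simps:
  "\<kappa> (x - y) z = \<kappa> x z - \<kappa> y z" "\<kappa> (sl2_scale c x) z = c * \<kappa> x z" "\<kappa> (sl2_bracket u y) u = 0"
  by (simp_all add: trace_form_coords algebra_simps)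

lemma circ_eq:
  "circ \<kappa> u x y = sl2_scale (\<kappa> (sl2_bracket x y) u) u - sl2_scale (\<kappa> x u) (sl2_bracket u y)"
  by (simp add: circ_def T_map_def sl2_bracket_scale_left)

text \<open>Both triple products are totally symmetric, which makes left symmetry and right commutativity
  immediate. They are computed from two facts about \<open>m = x \<circ> y\<close>: it is orthogonal to \<open>u\<close>, and its
  bracket with \<open>u\<close> is a multiple of \<open>u\<close> by the double bracket formula.\<close>

lemma
  assumes u: "\<kappa> u u = 0"
  shows circ_circ_left: "circ \<kappa> u (circ \<kappa> u x y) z = sl2_scale (2 * \<kappa> x u * \<kappa> y u * \<kappa> z u) u"
    and circ_circ_right: "circ \<kappa> u x (circ \<kappa> u y z) = sl2_scale (- 4 * \<kappa> x u * \<kappa> y u * \<kappa> z u) u"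
proof -
  have form: "\<kappa> (circ \<kappa> u x y) u = 0" for x y
    by (simp add: circ_eq form_simps u)
  have bracket: "sl2_bracket u (circ \<kappa> u x y) = sl2_scale (2 * \<kappa> x u * \<kappa> y u) u" for x y
  proof -
    have "sl2_bracket u (circ \<kappa> u x y) = sl2_scale (\<kappa> (sl2_bracket x y) u) (sl2_bracket u u)
        - sl2_scale (\<kappa> x u) (sl2_bracket u (sl2_bracket u y))"
      unfolding circ_eq by (simp add: sl2_eq_iff algebra_simps)
    then show ?thesis
      by (simp add: isotropic_bracket_bracket[OF u] sl2_bracket_self sl2_eq_iff)
  qed
  have move: "\<kappa> (sl2_bracket x y) u = \<kappa> (sl2_bracket u x) y" for x y
    by (simp add: trace_form_coords algebra_simps)
  show "circ \<kappa> u (circ \<kappa> u x y) z = sl2_scale (2 * \<kappa> x u * \<kappa> y u * \<kappa> z u) u"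
    unfolding circ_eq[of _ "circ \<kappa> u x y"] move bracket form
    by (simp add: form_simps sl2_trace_form_sym[of u] sl2_eq_iff)
  have "\<kappa> (sl2_bracket x m) u = - \<kappa> (sl2_bracket u m) x" for m
    by (simp add: trace_form_coords algebra_simps)
  then show "circ \<kappa> u x (circ \<kappa> u y z) = sl2_scale (- 4 * \<kappa> x u * \<kappa> y u * \<kappa> z u) u"
    unfolding circ_eq[of _ x]
    by (simp add: bracket form_simps sl2_trace_form_sym[of u] sl2_eq_iff algebra_simps)
qed

lemma T_map_linear: "Vector_Spaces.linear sl2_scale sl2_scale (T_map \<kappa> u)"
  by (intro sl2_endomorphismI) (simp_all add: T_map_def trace_form_coords sl2_eq_iff algebra_simps)

lemma gd_products_iff:
  "p \<in> gd_products sl2_scale sl2_bracket \<longleftrightarrow>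
     bilinear_map sl2_scale sl2_scale p \<and> gd_cocycle p \<and>
     (\<forall>x y z. p (p x y) z - p x (p y z) = p (p y x) z - p y (p x z)) \<and>
     (\<forall>x y z. p (p x y) z = p (p x z) y)"
  using sl2_lie_algebra sl2_vector_space
  by (auto simp: gd_products_def gd_algebra_def gd_algebra_axioms_def novikov_algebra_def
      novikov_algebra_axioms_def gd_cocycle_def)

lemma circ_gd_product:
  assumes "u \<in> isotropic_cone \<kappa>"
  shows "circ \<kappa> u \<in> gd_products sl2_scale sl2_bracket"
proof -
  have u: "\<kappa> u u = 0" using assms by (simp add: isotropic_cone_def)
  have "bilinear_map sl2_scale sl2_scale (circ \<kappa> u)" "gd_cocycle (circ \<kappa> u)"
    unfolding circ_coboundary
    by (intro coboundary_product_bilinear coboundary_product_cocycle T_map_linear)+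
  then show ?thesis
    by (simp add: gd_products_iff circ_circ_left[OF u] circ_circ_right[OF u] mult_ac)
qed

section \<open>Classification\<close>

lemma gd_product_is_circ:
  assumes "p \<in> gd_products sl2_scale sl2_bracket"
  obtains u where "u \<in> isotropic_cone \<kappa>" "p = circ \<kappa> u"
proof -
  have bil: "bilinear_map sl2_scale sl2_scale p" and coc: "gd_cocycle p"
    and rc: "p (p x y) z = p (p x z) y" for x y z
    using assms by (auto simp: gd_products_iff)
  obtain T where T: "Vector_Spaces.linear sl2_scale sl2_scale T" and p: "p = coboundary_product T"
    using whitehead_cocycle_is_coboundary[OF bil coc] .
  obtain k a s0 s1 s2 s3 s4 where
    dec: "T x = sl2_scale k x + (sl2_bracket a x + quartic_map s0 s1 s2 s3 s4 x)" for x
    by (metis endomorphism_decomposition[OF T])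
  have p': "p = coboundary_product (\<lambda>x. sl2_bracket a x + quartic_map s0 s1 s2 s3 s4 x)"
    unfolding p by (rule coboundary_product_mod_scalars) (rule dec)
  note constraints = right_commutative_endomorphism[of a s0 s1 s2 s3 s4, folded p', OF rc]
  obtain \<alpha> \<beta> \<gamma> where iso: "\<beta>\<^sup>2 = - (\<alpha> * \<gamma>)" and
    s: "s4 = \<alpha>\<^sup>2" "s3 = \<alpha> * \<beta>" "s2 = - (\<alpha> * \<gamma>)" "s1 = \<beta> * \<gamma>" "s0 = \<gamma>\<^sup>2"
    using veronese_parametrization[of s2 s4 s3 s1 s0] constraints by metis
  define u where "u = sl2_of \<alpha> \<beta> \<gamma>"
  have "u \<in> isotropic_cone \<kappa>"
    using iso unfolding isotropic_cone_def mem_Collect_eq trace_form_coords u_def coord_sl2_of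
    by algebra
  moreover have "sl2_bracket 0 x = 0" for x
    by (simp add: sl2_eq_iff)
  then have "p = circ \<kappa> u"
    by (simp add: p' circ_coboundary constraints(1) s quartic_map_isotropic[OF iso] u_def)
  ultimately show ?thesis by (rule that)
qed

text \<open>Five coordinates of products of basis vectors determine the pairwise products of the coordinates
  of \<open>u\<close>, with isotropy supplying the missing one, and these fix \<open>u\<close> up to sign.\<close>

lemma circ_eq_iff:
  assumes u: "u \<in> isotropic_cone \<kappa>" and v: "v \<in> isotropic_cone \<kappa>"
  shows "circ \<kappa> u = circ \<kappa> v \<longleftrightarrow> v = u \<or> v = - u"
proof
  assume eq: "circ \<kappa> u = circ \<kappa> v"
  have iso: "ce w * cf w = - (ch w)\<^sup>2" if "w \<in> isotropic_cone \<kappa>" for w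
    using that unfolding isotropic_cone_def mem_Collect_eq trace_form_coords by algebra
  note circ_simps = circ_eq trace_form_coords power2_eq_square
  have "cf (circ \<kappa> w sl2_f sl2_f) = 2 * (ce w * ch w)" "ch (circ \<kappa> w sl2_f sl2_f) = - (ce w)\<^sup>2"
    "ch (circ \<kappa> w sl2_e sl2_e) = (cf w)\<^sup>2" "ce (circ \<kappa> w sl2_e sl2_e) = - 2 * (ch w * cf w)"
    "ch (circ \<kappa> w sl2_e sl2_f) = 2 * (ch w)\<^sup>2 - ce w * cf w" for w
    by (simp_all add: circ_simps)
  from this[of u] this[of v] iso[OF u] iso[OF v]
  have sq: "(ce u)\<^sup>2 = (ce v)\<^sup>2" "(ch u)\<^sup>2 = (ch v)\<^sup>2" "(cf u)\<^sup>2 = (cf v)\<^sup>2"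
    and mixed: "ce u * ch u = ce v * ch v" "ch u * cf u = ch v * cf v"
    by (simp_all add: eq)
  have "ce u * cf u = ce v * cf v" using iso[OF u] iso[OF v] sq by simp
  then show "v = u \<or> v = - u"
    using sq mixed by (auto simp: sl2_eq_iff power2_eq_iff)
next
  assume "v = u \<or> v = - u"
  moreover have "T_map \<kappa> (- u) = T_map \<kappa> u"
    by (intro ext) (simp add: T_map_def trace_form_coords sl2_eq_iff algebra_simps)
  ultimately show "circ \<kappa> u = circ \<kappa> v"
    by (auto simp: circ_coboundary)
qed

lemma kernel_quotient_bij:
  assumes R: "R = {(x, y). x \<in> A \<and> y \<in> A \<and> f x = f y}"
  shows "equiv A R" and "\<exists>\<Phi>. (\<forall>x\<in>A. \<Phi> (R `` {x}) = f x) \<and> bij_betw \<Phi> (A // R) (f ` A)"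
proof -
  show "equiv A R"
    by (auto simp: R equiv_def refl_on_def sym_def trans_def)
  have "f ` (R `` {x}) = {f x}" if "x \<in> A" for x
    using that by (auto simp: R image_iff)
  then have \<Phi>: "the_elem (f ` (R `` {x})) = f x" if "x \<in> A" for x
    using that by simp
  have "bij_betw (\<lambda>C. the_elem (f ` C)) (A // R) (f ` A)"
    unfolding bij_betw_def
  proof
    show "inj_on (\<lambda>C. the_elem (f ` C)) (A // R)"
      by (rule inj_onI) (auto elim!: quotientE simp: \<Phi>, auto simp: R)
    show "(\<lambda>C. the_elem (f ` C)) ` (A // R) = f ` A"
      by (auto simp: \<Phi> quotient_def image_iff)
  qed
  with \<Phi> show "\<exists>\<Phi>. (\<forall>x\<in>A. \<Phi> (R `` {x}) = f x) \<and> bij_betw \<Phi> (A // R) (f ` A)"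
    by (intro exI[of _ "\<lambda>C. the_elem (f ` C)"]) auto
qed

theorem theorem6p9:
  fixes B :: "sl2 \<Rightarrow> sl2 \<Rightarrow> complex"
  assumes "invariant_symmetric_form B"
    and "B sl2_e sl2_f = 1"
    and "B sl2_h sl2_h = 2"
  shows "equiv (isotropic_cone B) (sign_rel B) \<and>
    (\<exists>\<Phi>. (\<forall>u \<in> isotropic_cone B. \<Phi> (sign_rel B `` {u}) = circ B u) \<and>
         bij_betw \<Phi> (isotropic_cone B // sign_rel B) (gd_products sl2_scale sl2_bracket))"
proof -
  have B: "B = \<kappa>" using invariant_form_unique[OF assms] .
  have "sign_rel \<kappa> = {(u, v). u \<in> isotropic_cone \<kappa> \<and> v \<in> isotropic_cone \<kappa> \<and> circ \<kappa> u = circ \<kappa> v}"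
    by (auto simp: sign_rel_def circ_eq_iff)
  note quotient = kernel_quotient_bij[OF this]
  moreover have "circ \<kappa> ` isotropic_cone \<kappa> = gd_products sl2_scale sl2_bracket"
    using circ_gd_product by (auto elim: gd_product_is_circ)
  ultimately show ?thesis unfolding B by simp
qed

end
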